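(* Let $R$ be a ring with involution, let $a\in R$ be regular and let $a^{(1)}$ be an inner inverse of $a$. Then the following conditions are equivalent: (i) $a$ is both left and right g-MP invertible; (ii) $u=aa^*a+1-aa^{(1)}$ is invertible; (iii) $v=aa^*a+1-a^{(1)}a$ is invertible.
   Context: Rings are associative and unital. An involution on $R$ is a map $*:R\to R$ with $(a^* )^*=a$, $(ab)^*=b^*a^*$ and $(a+b)^*=a^*+b^*$ for all $a,b\in R$. An element $a\in R$ is regular if there exists $x\in R$ with $axa=a$; such an $x$ is called an inner inverse of $a$ and denoted $a^{(1)}$. The element $a$ is left g-MP invertible if $Ra=Ra^2=Raa^*a$, and right g-MP invertible if $aR=a^2R=aa^*aR$. *)

theory Defs
  imports Main
begin

text \<open>
  Unital associative rings are types of sort \<open>{ring, monoid_mult}\<close>. The class \<open>ring_1\<close> is this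
  sort together with \<open>0 \<noteq> 1\<close>, so it would exclude the zero ring.
\<close>

definition involution :: "('a::{ring, monoid_mult} \<Rightarrow> 'a) \<Rightarrow> bool" where
  "involution star \<longleftrightarrow>
     (\<forall>a. star (star a) = a) \<and>
     (\<forall>a b. star (a * b) = star b * star a) \<and>
     (\<forall>a b. star (a + b) = star a + star b)"

definition inner_inverse :: "'a::{ring, monoid_mult} \<Rightarrow> 'a \<Rightarrow> bool" where
  "inner_inverse a x \<longleftrightarrow> a * x * a = a"

definition regular :: "'a::{ring, monoid_mult} \<Rightarrow> bool" where
  "regular a \<longleftrightarrow> (\<exists>x. inner_inverse a x)"

definition principal_left_ideal :: "'a::{ring, monoid_mult} \<Rightarrow> 'a set" where
  "principal_left_ideal a = {r * a | r. True}"

definition principal_right_ideal :: "'a::{ring, monoid_mult} \<Rightarrow> 'a set" where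
  "principal_right_ideal a = {a * r | r. True}"

definition left_gMP_invertible :: "('a::{ring, monoid_mult} \<Rightarrow> 'a) \<Rightarrow> 'a \<Rightarrow> bool" where
  "left_gMP_invertible star a \<longleftrightarrow>
     principal_left_ideal a = principal_left_ideal (a ^ 2) \<and>
     principal_left_ideal (a ^ 2) = principal_left_ideal (a * star a * a)"

definition right_gMP_invertible :: "('a::{ring, monoid_mult} \<Rightarrow> 'a) \<Rightarrow> 'a \<Rightarrow> bool" where
  "right_gMP_invertible star a \<longleftrightarrow>
     principal_right_ideal a = principal_right_ideal (a ^ 2) \<and>
     principal_right_ideal (a ^ 2) = principal_right_ideal (a * star a * a)"

text \<open>
  Two-sided invertibility. In a noncommutative ring \<open>a dvd 1\<close> only says that \<open>a\<close> has a right
  inverse.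
\<close>

definition ring_invertible :: "'a::{ring, monoid_mult} \<Rightarrow> bool" where
  "ring_invertible a \<longleftrightarrow> (\<exists>b. a * b = 1 \<and> b * a = 1)"

end

theory Submission
  imports Defs
begin

text \<open>
  Put \<open>e = a a\<^sup>(\<^sup>1\<^sup>)\<close>, \<open>c = a a\<^sup>* e\<close> and \<open>d = a e\<close>. Invertibility of \<open>u\<close> in \<open>R\<close> amounts to invertibility
  of \<open>c d\<close> in the corner ring \<open>e R e\<close>, and, after transport along \<open>a\<close>, invertibility of \<open>v\<close> amounts
  to invertibility of \<open>d c\<close> in \<open>e R e\<close>, while (i) says that both \<open>c\<close> and \<open>d\<close> are invertible there.
  The involution forces \<open>c\<close> to be left invertible as soon as it is right invertible and conversely,
  so in all three cases \<open>c\<close> and \<open>d\<close> are units.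
\<close>

lemma ring_invertibleI:
  fixes u :: "'a::{ring, monoid_mult}"
  assumes "u * r = 1" "l * u = 1"
  shows "ring_invertible u"
proof -
  have "l = l * (u * r)" using assms(1) by simp
  also have "\<dots> = r" using assms(2) by (simp add: mult.assoc[symmetric])
  finally show ?thesis using assms unfolding ring_invertible_def by blast
qed

text \<open>Since \<open>a ^ 2\<close> and \<open>a * star a * a\<close> are left multiples of
  \<open>a\<close>, equality of the ideals only requires that \<open>a\<close> lie in the smaller
  ones.\<close>

lemma left_gMP_invertible_iff:
  "left_gMP_invertible star a \<longleftrightarrow> (\<exists>s. a = s * a * a) \<and> (\<exists>l. a = l * a * star a * a)"
proof
  assume "left_gMP_invertible star a"
  moreover have "a \<in> principal_left_ideal a"
    unfolding principal_left_ideal_def by (metis (mono_tags) mem_Collect_eq mult_1_left)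
  ultimately have "a \<in> principal_left_ideal (a ^ 2)" "a \<in> principal_left_ideal (a * star a * a)"
    unfolding left_gMP_invertible_def by auto
  then show "(\<exists>s. a = s * a * a) \<and> (\<exists>l. a = l * a * star a * a)"
    unfolding principal_left_ideal_def by (auto simp: power2_eq_square mult.assoc)
next
  assume "(\<exists>s. a = s * a * a) \<and> (\<exists>l. a = l * a * star a * a)"
  then obtain s l where s: "a = s * a * a" and l: "a = l * a * star a * a" by blast
  have "principal_left_ideal a = principal_left_ideal (a ^ 2)"
    unfolding principal_left_ideal_def power2_eq_square using s
    by (safe; metis mult.assoc)
  moreover have "principal_left_ideal a = principal_left_ideal (a * star a * a)"
    unfolding principal_left_ideal_def using l by (safe; metis mult.assoc)
  ultimately show "left_gMP_invertible star a" unfolding left_gMP_invertible_def by simp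
qed

lemma right_gMP_invertible_iff:
  "right_gMP_invertible star a \<longleftrightarrow> (\<exists>t. a = a * a * t) \<and> (\<exists>k. a = a * star a * a * k)"
proof
  assume "right_gMP_invertible star a"
  moreover have "a \<in> principal_right_ideal a"
    unfolding principal_right_ideal_def by (metis (mono_tags) mem_Collect_eq mult_1_right)
  ultimately have "a \<in> principal_right_ideal (a ^ 2)" "a \<in> principal_right_ideal (a * star a * a)"
    unfolding right_gMP_invertible_def by auto
  then show "(\<exists>t. a = a * a * t) \<and> (\<exists>k. a = a * star a * a * k)"
    unfolding principal_right_ideal_def by (auto simp: power2_eq_square)
next
  assume "(\<exists>t. a = a * a * t) \<and> (\<exists>k. a = a * star a * a * k)"
  then obtain t k where t: "a = a * a * t" and k: "a = a * star a * a * k" by blast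
  have "principal_right_ideal a = principal_right_ideal (a ^ 2)"
    unfolding principal_right_ideal_def power2_eq_square using t
    by (safe; metis mult.assoc)
  moreover have "principal_right_ideal a = principal_right_ideal (a * star a * a)"
    unfolding principal_right_ideal_def using k by (safe; metis mult.assoc)
  ultimately show "right_gMP_invertible star a" unfolding right_gMP_invertible_def by simp
qed

text \<open>The adjoint of the hypothesis expresses \<open>star a\<close> as
  \<open>star t * star a * a * star a\<close>. Substituting this for \<open>star a\<close> in the
  hypothesis collapses it to \<open>a = a * star t * star a * a\<close>; a second substitution
  produces the factor \<open>a * star a * a\<close> on the right.\<close>

lemma involution_right_imp_left:
  assumes "involution star" and t: "a = a * star a * a * t"
  shows "\<exists>l. a = l * a * star a * a"
proof -
  have inv: "star (star x) = x" "star (x * y) = star y * star x" for x y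
    using assms(1) by (auto simp: involution_def)
  have st: "star a = star t * star a * a * star a"
    using arg_cong[OF t, of star] by (simp add: inv mult.assoc)
  have "a = a * (star t * star a * a * star a) * a * t" using t st by metis
  also have "\<dots> = a * star t * star a * (a * star a * a * t)" by (simp add: mult.assoc)
  also have "\<dots> = a * star t * star a * a" using t by metis
  also have "\<dots> = a * star t * (star t * star a * a * star a) * a" using st by metis
  also have "\<dots> = (a * star t * star t * star a) * a * star a * a" by (simp add: mult.assoc)
  finally show ?thesis by blast
qed

lemma involution_left_imp_right:
  assumes "involution star" and l: "a = l * a * star a * a"
  shows "\<exists>k. a = a * star a * a * k"
proof -
  have inv: "star (star x) = x" "star (x * y) = star y * star x" for x y
    using assms(1) by (auto simp: involution_def)
  have st: "star a = star a * a * star a * star l"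
    using arg_cong[OF l, of star] by (simp add: inv mult.assoc)
  have "a = l * a * (star a * a * star a * star l) * a" using l st by metis
  also have "\<dots> = (l * a * star a * a) * star a * star l * a" by (simp add: mult.assoc)
  also have "\<dots> = a * star a * star l * a" using l by metis
  also have "\<dots> = a * (star a * a * star a * star l) * star l * a" using st by metis
  also have "\<dots> = a * star a * a * (star a * star l * star l * a)" by (simp add: mult.assoc)
  finally show ?thesis by blast
qed

text \<open>
  The hypotheses say that \<open>b e\<close> is a unit of the corner ring \<open>e R e\<close>; relative to the Peirce
  decomposition of \<open>e\<close>, the element \<open>b + 1 - e\<close> is upper triangular with diagonal \<open>b e\<close> and \<open>1 - e\<close>.
\<close>

lemma ring_invertible_corner_left:
  fixes b e :: "'a::{ring, monoid_mult}"
  assumes e: "e * e = e" "e * b = b" and m: "b * e * m = e" and n: "n * b * e = e"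
  shows "ring_invertible (b + 1 - e)"
proof (rule ring_invertibleI)
  have e': "e * (e * y) = e * y" "e * (b * y) = b * y" "b * (e * (m * y)) = e * y" for y
    using e m by (simp_all add: mult.assoc[symmetric])
  have nbb: "n * (b * b) = b"
    using e n by (metis mult.assoc)
  \<comment> \<open>Inverse of a triangular matrix with rows (p, q) and (0, 1): the corner entry is
    -p^(-1) q, where q is \<open>b * (1 - e)\<close> and the given one-sided inverses
    \<open>m\<close> and \<open>n\<close> stand for p^(-1).\<close>
  show "(b + 1 - e) * (e * m + (1 - e) - e * m * b * (1 - e)) = 1"
    using e e' m by (simp add: algebra_simps)
  show "(n * e + (1 - e) - n * b * (1 - e)) * (b + 1 - e) = 1"
    using e e' n nbb by (simp add: algebra_simps)
qed

text \<open>Here \<open>b = b * f\<close> makes \<open>b + 1 - f\<close> lower triangular for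
  \<open>f\<close>, with diagonal \<open>f * b\<close> and \<open>1 - f\<close>; the corner entry of
  the inverse is now -q p^(-1) with q = \<open>(1 - f) * b\<close>.\<close>

lemma ring_invertible_corner_right:
  fixes b f :: "'a::{ring, monoid_mult}"
  assumes f: "f * f = f" "b * f = b" and m: "f * b * m = f" and n: "n * f * b = f"
  shows "ring_invertible (b + 1 - f)"
proof (rule ring_invertibleI)
  have f': "f * (f * y) = f * y" "b * (f * y) = b * y" "f * (b * (m * y)) = f * y"
    "n * (f * (b * y)) = f * y" for y
    using f m n by (simp_all add: mult.assoc[symmetric])
  have bbm: "b * (b * m) = b"
    using f m by (metis mult.assoc)
  show "(n * f + (1 - f) - (1 - f) * b * n * f) * (b + 1 - f) = 1"
    using f f' n by (simp add: algebra_simps)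
  show "(b + 1 - f) * (f * m + (1 - f) - (1 - f) * b * m) = 1"
    using f f' m bbm by (simp add: algebra_simps)
qed

lemma gMP_imp_ring_invertible:
  fixes a a1 :: "'a::{ring, monoid_mult}"
  assumes "left_gMP_invertible star a" "right_gMP_invertible star a" and x: "a * a1 * a = a"
  shows "ring_invertible (a * star a * a + 1 - a * a1)"
    and "ring_invertible (a * star a * a + 1 - a1 * a)"
proof -
  obtain s l where s: "a = s * a * a" and l: "a = l * a * star a * a"
    using assms(1) unfolding left_gMP_invertible_iff by blast
  obtain t k where t: "a = a * a * t" and k: "a = a * star a * a * k"
    using assms(2) unfolding right_gMP_invertible_iff by blast
  have x': "a * (a1 * a) = a" "a * (a1 * (a * y)) = a * y" for y
    using x by (simp_all add: mult.assoc[symmetric])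
  have t': "a * (a * t) = a" "a * (a * (t * y)) = a * y" for y
    using t by (metis mult.assoc)+
  have k': "a * (star a * (a * k)) = a" "a * (star a * (a * (k * y))) = a * y" for y
    using k by (metis mult.assoc)+
  have s': "s * (a * a) = a" "s * (a * (a * y)) = a * y" for y
    using s by (metis mult.assoc)+
  have l': "l * (a * (star a * a)) = a" "l * (a * (star a * (a * y))) = a * y" for y
    using l by (metis mult.assoc)+
  \<comment> \<open>In \<open>a * star a * a * a\<close>, the witness \<open>m\<close> cancels by
    \<open>t\<close> first and then by \<open>k\<close>; \<open>n\<close> cancels by
    \<open>l\<close> first and then by \<open>s\<close>.\<close>
  show "ring_invertible (a * star a * a + 1 - a * a1)"
    by (rule ring_invertible_corner_left[where m = "a * t * k * a1" and n = "s * l"])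
      (simp_all add: mult.assoc x' t' k' s' l')
  \<comment> \<open>In \<open>a * a * star a * a\<close> the order of the cancellations is
    reversed.\<close>
  show "ring_invertible (a * star a * a + 1 - a1 * a)"
    by (rule ring_invertible_corner_right[where m = "k * t" and n = "a1 * l * s * a"])
      (simp_all add: mult.assoc x' t' k' s' l')
qed

text \<open>Writing \<open>u = b + 1 - e\<close>, the identities \<open>e * u = b\<close> and
  \<open>u * a = b * a\<close> yield every condition except \<open>a = a * a * t\<close>, once the
  involution has supplied \<open>l\<close>.\<close>

lemma ring_invertible_imp_gMP:
  fixes a a1 :: "'a::{ring, monoid_mult}"
  assumes "involution star" and x: "a * a1 * a = a"
    and "ring_invertible (a * star a * a + 1 - a * a1)"
  shows "left_gMP_invertible star a \<and> right_gMP_invertible star a"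
proof -
  define b where "b = a * star a * a"
  define e where "e = a * a1"
  obtain w where uw: "(b + 1 - e) * w = 1" and wu: "w * (b + 1 - e) = 1"
    using assms(3) unfolding ring_invertible_def b_def e_def by blast
  have ea: "e * a = a" and eb: "e * b = b"
    using x by (simp_all add: e_def b_def mult.assoc[symmetric])
  have ee: "e * e = e" using ea by (simp add: e_def mult.assoc[symmetric])
  have "a = w * (b + 1 - e) * a" using wu by simp
  also have "\<dots> = w * b * a" using ea by (simp add: algebra_simps)
  finally have left_a2: "a = (w * a * star a) * a * a" by (simp add: b_def mult.assoc)
  have e_bw: "e = b * w"
  proof -
    have "e = e * ((b + 1 - e) * w)" using uw by simp
    also have "\<dots> = b * w" using ee eb by (simp add: algebra_simps flip: mult.assoc)
    finally show ?thesis .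
  qed
  then have k: "a = a * star a * a * (w * a)" using ea by (metis b_def mult.assoc)
  then obtain l where l: "a = l * a * star a * a"
    using involution_right_imp_left[OF assms(1)] by blast
  \<comment> \<open>The lower row of \<open>b + 1 - e\<close> is \<open>1 - e\<close>, so its
    inverse \<open>w\<close> is upper triangular too and maps \<open>a\<close> into aR.\<close>
  have "(1 - e) * w = (1 - e) * ((b + 1 - e) * w)"
    using ee eb by (simp add: algebra_simps flip: mult.assoc)
  also have "\<dots> = 1 - e" using uw by simp
  finally have "(1 - e) * w * e = 0" using ee by (simp add: left_diff_distrib)
  then have "w * e = e * w * e" by (simp add: left_diff_distrib)
  then have wa: "w * a = a * a1 * w * a" using ea by (metis e_def mult.assoc)
  text \<open>Since \<open>a = b w a\<close> with \<open>w a \<in> a R\<close>, cancelling \<open>l\<close> in \<open>b = (b w a) a\<^sup>* a\<close> exhibits \<open>a \<in> a\<^sup>2 R\<close>.\<close>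
  have "a = l * b" using l by (simp add: b_def mult.assoc)
  also have "\<dots> = l * ((b * (w * a)) * star a * a)" using k by (metis b_def)
  also have "\<dots> = (l * b) * (w * a) * star a * a" by (simp add: mult.assoc)
  also have "\<dots> = a * (a * a1 * w * a) * star a * a"
    using \<open>a = l * b\<close> wa by metis
  also have "\<dots> = a * a * (a1 * w * a * star a * a)" by (simp add: mult.assoc)
  finally have "a = a * a * (a1 * w * a * star a * a)" .
  with left_a2 k l show ?thesis
    unfolding left_gMP_invertible_iff right_gMP_invertible_iff by blast
qed

text \<open>Passing to the opposite ring interchanges the two elements, so the previous argument is
  mirrored with \<open>f = a1 * a\<close> in place of \<open>e\<close>.\<close>

lemma ring_invertible_imp_gMP':
  fixes a a1 :: "'a::{ring, monoid_mult}"
  assumes "involution star" and x: "a * a1 * a = a"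
    and "ring_invertible (a * star a * a + 1 - a1 * a)"
  shows "left_gMP_invertible star a \<and> right_gMP_invertible star a"
proof -
  define b where "b = a * star a * a"
  define f where "f = a1 * a"
  obtain w where vw: "(b + 1 - f) * w = 1" and wv: "w * (b + 1 - f) = 1"
    using assms(3) unfolding ring_invertible_def b_def f_def by blast
  have af: "a * f = a" and bf: "b * f = b"
    using x by (simp_all add: f_def b_def mult.assoc)
  have ff: "f * f = f" using af by (simp add: f_def mult.assoc)
  have "a = a * ((b + 1 - f) * w)" using vw by simp
  also have "\<dots> = a * b * w" using af by (simp add: algebra_simps flip: mult.assoc)
  finally have right_a2: "a = a * a * (star a * a * w)" by (simp add: b_def mult.assoc)
  have f_wb: "f = w * b"
  proof -
    have "f = w * (b + 1 - f) * f" using wv by simp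
    also have "\<dots> = w * b" using ff bf by (simp add: algebra_simps)
    finally show ?thesis .
  qed
  then have l: "a = (a * w) * a * star a * a" using af by (metis b_def mult.assoc)
  then obtain k where k: "a = a * star a * a * k"
    using involution_left_imp_right[OF assms(1)] by blast
  have "w * (1 - f) = w * (b + 1 - f) * (1 - f)"
    using ff bf by (simp add: algebra_simps)
  also have "\<dots> = 1 - f" using wv by simp
  finally have "f * (w * (1 - f)) = 0" using ff by (simp add: right_diff_distrib)
  then have "f * w = f * w * f" by (simp add: right_diff_distrib flip: mult.assoc)
  then have aw: "a * w = a * w * a1 * a" using af by (metis f_def mult.assoc)
  \<comment> \<open>With \<open>a * w\<close> in Ra, cancelling \<open>k\<close> in
    \<open>b = a * star a * (a * w * b)\<close> exhibits \<open>a\<close> in the left ideal of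
    \<open>a * a\<close>.\<close>
  have bk: "a = b * k" using k by (simp add: b_def)
  also have "\<dots> = (a * star a * ((a * w) * b)) * k" using l by (metis b_def mult.assoc)
  also have "\<dots> = a * star a * (a * w) * (b * k)" by (simp add: mult.assoc)
  also have "\<dots> = a * star a * (a * w * a1 * a) * a" using bk aw by metis
  also have "\<dots> = (a * star a * a * w * a1) * a * a" by (simp add: mult.assoc)
  finally have "a = (a * star a * a * w * a1) * a * a" .
  with right_a2 k l show ?thesis
    unfolding left_gMP_invertible_iff right_gMP_invertible_iff by blast
qed

theorem theorem3p7:
  fixes star :: "'a::{ring, monoid_mult} \<Rightarrow> 'a"
    and a a1 :: 'a
  assumes "involution star"
    and "regular a"
    and "inner_inverse a a1"
  shows "(left_gMP_invertible star a \<and> right_gMP_invertible star a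
            \<longleftrightarrow> ring_invertible (a * star a * a + 1 - a * a1)) \<and>
         (ring_invertible (a * star a * a + 1 - a * a1)
            \<longleftrightarrow> ring_invertible (a * star a * a + 1 - a1 * a))"
proof -
  have x: "a * a1 * a = a" using assms(3) by (simp add: inner_inverse_def)
  show ?thesis
    using gMP_imp_ring_invertible[OF _ _ x] ring_invertible_imp_gMP[OF assms(1) x]
      ring_invertible_imp_gMP'[OF assms(1) x] by blast
qed

end
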